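(* Let $\gamma=\begin{pmatrix}a&b\\c&d\end{pmatrix}\in\mathrm{GL}_2(F)$ and $s,t\in F$ be such that $\gamma(s)\neq\infty$ and $\gamma(t)\neq\infty$. Let $w\in\mathcal{A}$ be a non-constant monomial, written as $w=e_xw'=w''e_y$ with $x,y\in F$ and $w',w''$ monomials. Then $$\left(\gamma^{-1}\right)^{*}\partial^{\gamma(s),\gamma(t)}\gamma^{*}(w)=\partial^{s,t}w+\delta_{x,s}\,\varepsilon_\gamma(s)\,w'-\delta_{y,t}\,\varepsilon_\gamma(t)\,w''.$$ In particular, for all $w\in\mathcal{A}_{(s,t)}^0$, $$\left(\gamma^{-1}\right)^{*}\partial^{\gamma(s),\gamma(t)}\gamma^{*}(w)=\partial^{s,t}w.$$
   Context: Let $F$ be a field and let $\mathcal{A}=\mathcal{A}_F$ be the non-commutative free (unital, associative) algebra over $\mathbb{Z}$ generated by the indeterminates $\{e_p\mid p\in F\}$. A monomial is a word $e_{a_1}\cdots e_{a_n}$; it is non-constant if $n\geq1$. For $s,t\in F$ put $$\mathcal{A}_{(s,t)}^0=\mathbb{Z}\oplus\bigoplus_{z\in F\setminus\{s,t\}}\mathbb{Z}e_z\oplus\bigoplus_{x\in F\setminus\{s\},\,y\in F\setminus\{t\}}e_x\mathcal{A}e_y\subset\mathcal{A}.$$ Fix a group homomorphism $\mathfrak{F}:F^\times\to\mathbb{Z}$ (from the multiplicative group of $F$ to the additive group $\mathbb{Z}$), and for $x\in F$ put $[x]=\mathfrak{F}(x)$ if $x\neq0$ and $[0]=0$. For $s,t\in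 F$, the $\mathbb{Z}$-linear map $\partial^{s,t}:\mathcal{A}\to\mathcal{A}$ is defined on monomials by $$\partial^{s,t}(e_{a_1}\cdots e_{a_n})=\sum_{i=1}^n\left([a_{i+1}-a_i]-[a_i-a_{i-1}]\right)e_{a_1}\cdots\widehat{e_{a_i}}\cdots e_{a_n},\qquad (a_0,a_{n+1})=(s,t),$$ where the hat means that the factor is omitted (so $\partial^{s,t}(1)=0$). The group $\mathrm{GL}_2(F)$ acts on $\mathbb{P}^1(F)=F\sqcup\{\infty\}$ by Möbius transformations $\gamma(x)=\frac{ax+b}{cx+d}$ for $\gamma=\begin{pmatrix}a&b\\c&d\end{pmatrix}$. Put $e_\infty:=0$. For $\gamma\in\mathrm{GL}_2(F)$, $\gamma^*$ is the algebra automorphism of $\mathcal{A}$ defined by $\gamma^*(e_x)=e_{\gamma(x)}-e_{\gamma(\infty)}$ for $x\in F$. For $\gamma=\begin{pmatrix}a&b\\c&d\end{pmatrix}$ and $z\in F$ put $\varepsilon_\gamma(z):=[\det\gamma]-2[cz+d]\in\mathbb{Z}$. The symbol $\delta_{x,y}$ is the Kronecker delta. *)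

theory Defs
  imports "HOL-Analysis.Determinants" "HOL-Library.Poly_Mapping"
begin

text \<open>
  Lists form the free monoid; hence \<^typ>\<open>'a list \<Rightarrow>\<^sub>0 int\<close>, with the convolution
  product of \<^theory>\<open>HOL-Library.Poly_Mapping\<close>, is the free unital associative
  algebra over the integers on the generators \<^term>\<open>gen p\<close> below.
\<close>

instantiation list :: (type) monoid_add
begin

definition zero_list :: "'a list" where
  "zero_list = []"

definition plus_list :: "'a list \<Rightarrow> 'a list \<Rightarrow> 'a list" where
  "plus_list xs ys = xs @ ys"

instance
  by standard (simp_all add: zero_list_def plus_list_def)

end

type_synonym 'a free_alg = "'a list \<Rightarrow>\<^sub>0 int"

definition gen :: "'a \<Rightarrow> 'a free_alg" where
  "gen p = frag_of [p]"

definition monomials :: "'a free_alg set" where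
  "monomials = {w. \<exists>as. w = prod_list (map gen as)}"

text \<open>The words, on which linear maps are defined via \<^const>\<open>frag_extend\<close>, are the monomials:\<close>

lemma prod_list_gen: "prod_list (map gen as) = frag_of as"
  by (induction as)
    (simp_all add: gen_def mult_single plus_list_def zero_list_def flip: single_one)

text \<open>
  Direct sums inside the algebra are rendered as sums of additive subgroups: the set below
  is closed under negation since each of the three families of summands is.
\<close>

inductive_set alg0 :: "'a \<Rightarrow> 'a \<Rightarrow> 'a free_alg set" for s t :: 'a where
  const: "of_int n \<in> alg0 s t"
| gen: "z \<notin> {s, t} \<Longrightarrow> of_int n * gen z \<in> alg0 s t"
| sandwich: "x \<noteq> s \<Longrightarrow> y \<noteq> t \<Longrightarrow> gen x * p * gen y \<in> alg0 s t"
| add: "p \<in> alg0 s t \<Longrightarrow> q \<in> alg0 s t \<Longrightarrow> p + q \<in> alg0 s t"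

text \<open>
  A homomorphism from the multiplicative group of a field to the integers is represented by a
  total function \<open>\<phi>\<close> whose value at zero is irrelevant, as \<^term>\<open>bracket \<phi>\<close> overrides it.
\<close>

definition units_hom :: "('a::field \<Rightarrow> int) \<Rightarrow> bool" where
  "units_hom \<phi> \<longleftrightarrow> (\<forall>x y. x \<noteq> 0 \<longrightarrow> y \<noteq> 0 \<longrightarrow> \<phi> (x * y) = \<phi> x + \<phi> y)"

definition bracket :: "('a::field \<Rightarrow> int) \<Rightarrow> 'a \<Rightarrow> int" where
  "bracket \<phi> x = (if x = 0 then 0 else \<phi> x)"

text \<open>
  With \<open>bs = [s, a\<^sub>1, \<dots>, a\<^sub>n, t]\<close>, the entry \<open>bs ! Suc i\<close> is the letter \<open>as ! i\<close>,
  with neighbours \<open>bs ! i\<close> and \<open>bs ! Suc (Suc i)\<close>.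
\<close>

definition partial_word :: "('a::field \<Rightarrow> int) \<Rightarrow> 'a \<Rightarrow> 'a \<Rightarrow> 'a list \<Rightarrow> 'a free_alg" where
  "partial_word \<phi> s t as =
    (let bs = s # as @ [t] in
     \<Sum>i<length as.
       frag_cmul (bracket \<phi> (bs ! Suc (Suc i) - bs ! Suc i) - bracket \<phi> (bs ! Suc i - bs ! i))
         (prod_list (map gen (take i as @ drop (Suc i) as))))"

definition partial :: "('a::field \<Rightarrow> int) \<Rightarrow> 'a \<Rightarrow> 'a \<Rightarrow> 'a free_alg \<Rightarrow> 'a free_alg" where
  "partial \<phi> s t = frag_extend (partial_word \<phi> s t)"

lemma partial_monomial: "partial \<phi> s t (prod_list (map gen as)) = partial_word \<phi> s t as"
  by (simp add: partial_def prod_list_gen)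

datatype 'a proj_line = Affine (the_affine: 'a) | Infty

fun moebius :: "'a::field^2^2 \<Rightarrow> 'a proj_line \<Rightarrow> 'a proj_line" where
  "moebius \<gamma> (Affine x) =
    (if \<gamma>$2$1 * x + \<gamma>$2$2 = 0 then Infty
     else Affine ((\<gamma>$1$1 * x + \<gamma>$1$2) / (\<gamma>$2$1 * x + \<gamma>$2$2)))"
| "moebius \<gamma> Infty = (if \<gamma>$2$1 = 0 then Infty else Affine (\<gamma>$1$1 / \<gamma>$2$1))"

fun gen_proj :: "'a proj_line \<Rightarrow> 'a free_alg" where
  "gen_proj (Affine x) = gen x"
| "gen_proj Infty = 0"

definition gl_star_gen :: "'a::field^2^2 \<Rightarrow> 'a \<Rightarrow> 'a free_alg" where
  "gl_star_gen \<gamma> x = gen_proj (moebius \<gamma> (Affine x)) - gen_proj (moebius \<gamma> Infty)"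

definition gl_star :: "'a::field^2^2 \<Rightarrow> 'a free_alg \<Rightarrow> 'a free_alg" where
  "gl_star \<gamma> = frag_extend (\<lambda>as. prod_list (map (gl_star_gen \<gamma>) as))"

text \<open>This is the unital ring homomorphism with the prescribed values on the generators:\<close>

lemma gl_star_gen_eq: "gl_star \<gamma> (gen x) = gl_star_gen \<gamma> x"
  by (simp add: gl_star_def gen_def)

lemma gl_star_one: "gl_star \<gamma> 1 = 1"
  by (simp add: gl_star_def zero_list_def flip: single_one)

lemma gl_star_add: "gl_star \<gamma> (p + q) = gl_star \<gamma> p + gl_star \<gamma> q"
  by (simp add: gl_star_def frag_extend_add)

lemma gl_star_mult: "gl_star \<gamma> (p * q) = gl_star \<gamma> p * gl_star \<gamma> q"
proof -
  have word: "gl_star \<gamma> (frag_of as * frag_of bs) = gl_star \<gamma> (frag_of as) * gl_star \<gamma> (frag_of bs)"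
    for as bs
    by (simp add: gl_star_def mult_single plus_list_def)
  have right: "gl_star \<gamma> (frag_of as * q) = gl_star \<gamma> (frag_of as) * gl_star \<gamma> q" for as
    using subset_UNIV
  proof (induction q rule: frag_induction)
    case (diff a b)
    then show ?case
      by (simp add: gl_star_def frag_extend_diff right_diff_distrib)
  qed (simp_all add: word, simp add: gl_star_def)
  show ?thesis
    using subset_UNIV
  proof (induction p rule: frag_induction)
    case (diff a b)
    then show ?case
      by (simp add: gl_star_def frag_extend_diff left_diff_distrib)
  qed (simp_all add: right, simp add: gl_star_def)
qed

definition eps :: "('a::field \<Rightarrow> int) \<Rightarrow> 'a^2^2 \<Rightarrow> 'a \<Rightarrow> int" where
  "eps \<phi> \<gamma> z = bracket \<phi> (det \<gamma>) - 2 * bracket \<phi> (\<gamma>$2$1 * z + \<gamma>$2$2)"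

end

theory Submission
  imports Defs
begin

text \<open>
  Write \<open>[x]\<close> for \<^term>\<open>bracket \<phi> x\<close> and \<open>e\<close> for \<^const>\<open>gen\<close>. Collecting the coefficients of
  \<^const>\<open>partial\<close> by pairs of neighbouring letters instead of by letters splits the map into three
  operators (\<open>partial_eq_contract_drop\<close>): \<open>contract\<close> replaces a pair of neighbours
  \<open>e\<^sub>a e\<^sub>b\<close> by \<open>[b - a] (e\<^sub>b - e\<^sub>a)\<close> in all possible places and involves neither \<open>s\<close> nor
  \<open>t\<close>; the two boundary terms delete the first letter \<open>a\<close> with weight \<open>-[a - s]\<close> and the
  last letter \<open>a\<close> with weight \<open>[t - a]\<close>. Each operator only looks at one or two adjacent
  factors, so its behaviour under \<open>e\<^sub>x \<mapsto> e\<^bsub>\<gamma>x\<^esub> - e\<^bsub>\<gamma>\<infinity>\<^esub>\<close> can be computed locally.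

  The computation rests on a single identity for the brackets (\<open>bracket_three_point\<close>). From
  \<open>\<gamma>x - \<gamma>s = det \<gamma> (x - s) / ((cx + d) (cs + d))\<close> one obtains
  \<open>[\<gamma>x - \<gamma>s] - [\<gamma>\<infinity> - \<gamma>s] = [x - s] - H(x) - \<delta>\<^bsub>x,s\<^esub> \<epsilon>\<^sub>\<gamma>(s)\<close> (brackets involving \<open>\<infinity>\<close> read as zero),
  where \<open>H\<close>, called \<open>boundary_weight\<close> below, does not depend on \<open>s\<close>, and the Kronecker term is
  there because \<open>[0] = 0\<close> does not follow the multiplicative rule. For the boundary operators the
  left-hand side is the weight seen through \<open>\<gamma>\<close>, so that they commute with \<^term>\<open>gl_star \<gamma>\<close> up to
  deleting the end letters with weights \<open>H\<close> and \<open>\<delta> \<epsilon>\<close>. For a pair of neighbours, the same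
  identity shows that contracting their images gives the image of
  \<open>[y - x] (e\<^sub>y - e\<^sub>x) + H(y) e\<^sub>x - H(x) e\<^sub>y\<close> (\<open>contract_gl_star_pair\<close>).
  The last two terms delete the right letter of the pair with weight \<open>H\<close> and the left one with
  weight \<open>-H\<close>; summed over the pairs of a word they telescope to the two end letters
  (\<open>contract_gl_star\<close>) and cancel the \<open>H\<close>-terms of the boundary operators. Only the Kronecker
  terms remain (\<open>partial_gl_star\<close>), and applying \<open>(\<gamma>\<^sup>-\<^sup>1)\<^sup>*\<close>, which is the inverse of
  \<open>\<gamma>\<^sup>*\<close>, gives the formula. On \<^term>\<open>alg0 s t\<close> they vanish, as its elements have no word of
  positive length beginning with \<open>s\<close> or ending with \<open>t\<close>.
\<close>

section \<open>Linear maps on the free algebra\<close>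

lemma free_alg_eq_on_words:
  fixes F G :: "'a free_alg \<Rightarrow> 'a free_alg"
  assumes F: "\<And>p q. F (p - q) = F p - F q" and G: "\<And>p q. G (p - q) = G p - G q"
    and words: "\<And>as. F (frag_of as) = G (frag_of as)"
  shows "F p = G p"
  using subset_UNIV
proof (induction p rule: frag_induction)
  case zero
  show ?case
    using F[of 0 0] G[of 0 0] by simp
qed (simp_all add: F G words)

text \<open>Scalars become ring elements, so that ring normalisation covers linear combinations.\<close>

lemma frag_cmul_conv_mult: "frag_cmul c p = of_int c * p" for p :: "'a free_alg"
proof -
  have add: "frag_cmul (a + b) p = frag_cmul a p + frag_cmul b p" for a b
    by (simp add: frag_cmul_distrib)
  show ?thesis
  proof (induction c rule: int_induct[where k = 0])
    case (step2 i)
    have "frag_cmul (i - 1) p = frag_cmul i p - p"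
      by (simp add: frag_cmul_diff_distrib)
    then show ?case
      using step2 by (simp add: algebra_simps)
  qed (simp_all add: add algebra_simps)
qed

lemma frag_of_Nil: "frag_of [] = (1 :: 'a free_alg)"
  by (simp add: zero_list_def flip: single_one)

lemma frag_of_append: "frag_of (as @ bs) = (frag_of as * frag_of bs :: 'a free_alg)"
  by (simp add: mult_single plus_list_def)

lemma frag_of_Cons: "frag_of (a # as) = gen a * frag_of as"
  using frag_of_append[of "[a]" as] by (simp add: gen_def)

lemma gl_star_diff: "gl_star \<gamma> (p - q) = gl_star \<gamma> p - gl_star \<gamma> q"
  by (simp add: gl_star_def frag_extend_diff)

lemma gl_star_of_int_mult: "gl_star \<gamma> (of_int n * p) = of_int n * gl_star \<gamma> p"
  by (simp add: gl_star_def frag_extend_cmul flip: frag_cmul_conv_mult)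

lemma gl_star_of_int: "gl_star \<gamma> (of_int n) = of_int n"
  using gl_star_of_int_mult[of \<gamma> n 1] by (simp add: gl_star_one)

lemma partial_diff: "partial \<phi> s t (p - q) = partial \<phi> s t p - partial \<phi> s t q"
  by (simp add: partial_def frag_extend_diff)

section \<open>Splitting the differential into local operators\<close>

fun contract_word :: "('a::field \<Rightarrow> int) \<Rightarrow> 'a list \<Rightarrow> 'a free_alg" where
  "contract_word \<phi> (a # b # as) =
    of_int (bracket \<phi> (b - a)) * (gen b - gen a) * frag_of as + gen a * contract_word \<phi> (b # as)"
| "contract_word \<phi> _ = 0"

definition contract :: "('a::field \<Rightarrow> int) \<Rightarrow> 'a free_alg \<Rightarrow> 'a free_alg" where
  "contract \<phi> = frag_extend (contract_word \<phi>)"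

definition drop_first :: "('a \<Rightarrow> int) \<Rightarrow> 'a free_alg \<Rightarrow> 'a free_alg" where
  "drop_first f = frag_extend (\<lambda>as. if as = [] then 0 else of_int (f (hd as)) * frag_of (tl as))"

definition drop_last :: "('a \<Rightarrow> int) \<Rightarrow> 'a free_alg \<Rightarrow> 'a free_alg" where
  "drop_last f = frag_extend (\<lambda>as. if as = [] then 0 else of_int (f (last as)) * frag_of (butlast as))"

lemma contract_diff: "contract \<phi> (p - q) = contract \<phi> p - contract \<phi> q"
  by (simp add: contract_def frag_extend_diff)

lemma drop_diff:
  "drop_first f (p - q) = drop_first f p - drop_first f q"
  "drop_last f (p - q) = drop_last f p - drop_last f q"
  by (simp_all add: drop_first_def drop_last_def frag_extend_diff)

lemma drop_add:
  "drop_first f (p + q) = drop_first f p + drop_first f q"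
  "drop_last f (p + q) = drop_last f p + drop_last f q"
  by (simp_all add: drop_first_def drop_last_def frag_extend_add)

lemma contract_word: "contract \<phi> (frag_of as) = contract_word \<phi> as"
  by (simp add: contract_def)

lemma drop_word:
  "drop_first f (frag_of as) = (if as = [] then 0 else of_int (f (hd as)) * frag_of (tl as))"
  "drop_last f (frag_of as) = (if as = [] then 0 else of_int (f (last as)) * frag_of (butlast as))"
  by (simp_all add: drop_first_def drop_last_def)

lemma operators_zero [simp]:
  "gl_star \<gamma> 0 = 0" "contract \<phi> 0 = 0" "drop_first f 0 = 0" "drop_last f 0 = 0"
  by (simp_all add: gl_star_def contract_def drop_first_def drop_last_def)

lemma gen_mult_of_int:
  "gen a * of_int n = of_int n * gen a"
  "gen a * (of_int n * p) = of_int n * (gen a * p)"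
  by (simp add: mult_of_int_commute) (metis mult.assoc mult_of_int_commute)

lemma contract_gen: "contract \<phi> (gen a) = 0"
  by (simp add: contract_def gen_def)

lemma contract_gen_gen_mult:
  "contract \<phi> (gen a * (gen b * p)) =
    of_int (bracket \<phi> (b - a)) * (gen b - gen a) * p + gen a * contract \<phi> (gen b * p)"
  by (rule free_alg_eq_on_words)
    (simp_all add: contract_diff right_diff_distrib left_diff_distrib flip: frag_of_Cons,
      simp add: contract_word algebra_simps)

lemma drop_first_gen_mult: "drop_first f (gen a * p) = of_int (f a) * p"
  by (rule free_alg_eq_on_words[where F = "\<lambda>p. drop_first f (gen a * p)" and G = "\<lambda>p. of_int (f a) * p"])
    (simp_all add: drop_diff right_diff_distrib flip: frag_of_Cons, simp add: drop_word)

lemma drop_last_mult_gen: "drop_last f (p * gen a) = of_int (f a) * p"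
proof (rule free_alg_eq_on_words[where F = "\<lambda>p. drop_last f (p * gen a)" and G = "\<lambda>p. of_int (f a) * p"])
  show "drop_last f (frag_of as * gen a) = of_int (f a) * frag_of as" for as
    by (simp add: gen_def drop_word flip: frag_of_append)
qed (simp_all add: drop_diff algebra_simps)

text \<open>
  Past its first letter \<open>a\<close>, a word is differentiated as if \<open>a\<close> were its left boundary point.
\<close>

lemma partial_word_Cons:
  "partial_word \<phi> s t (a # as) =
    of_int (bracket \<phi> (hd (as @ [t]) - a) - bracket \<phi> (a - s)) * frag_of as
    + gen a * partial_word \<phi> a t as"
proof -
  have hd: "(as @ [t]) ! 0 = hd (as @ [t])"
    by (simp add: hd_conv_nth)
  show ?thesis
    unfolding partial_word_def Let_def prod_list_gen frag_cmul_conv_mult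
    by (simp add: sum.lessThan_Suc_shift hd frag_of_Cons sum_distrib_left
        del: sum.lessThan_Suc)
       (simp add: gen_mult_of_int algebra_simps)
qed

text \<open>
  For each pair of neighbours \<open>a\<close>, \<open>b\<close> the bracket \<open>[b - a]\<close> occurs twice in the differential: with sign
  \<open>+\<close> where \<open>a\<close> is deleted and with sign \<open>-\<close> where \<open>b\<close> is deleted. For the pairs formed
  with the boundary points only one of the two deletions takes place.
\<close>

lemma partial_eq_contract_drop:
  "partial \<phi> s t p =
    contract \<phi> p - drop_first (\<lambda>a. bracket \<phi> (a - s)) p + drop_last (\<lambda>a. bracket \<phi> (t - a)) p"
proof (rule free_alg_eq_on_words[where F = "partial \<phi> s t" and
      G = "\<lambda>p. contract \<phi> p - drop_first (\<lambda>a. bracket \<phi> (a - s)) p + drop_last (\<lambda>a. bracket \<phi> (t - a)) p"])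
  show "partial \<phi> s t (frag_of as) =
    contract \<phi> (frag_of as) - drop_first (\<lambda>a. bracket \<phi> (a - s)) (frag_of as)
      + drop_last (\<lambda>a. bracket \<phi> (t - a)) (frag_of as)" for as
  proof (induction as arbitrary: s rule: induct_list012)
    case 1
    then show ?case
      by (simp add: partial_def contract_word drop_word partial_word_def)
  next
    case (2 a)
    then show ?case
      by (simp add: partial_def contract_word drop_word partial_word_Cons)
         (simp add: partial_word_def frag_of_Nil)
  next
    case (3 a b as)
    then show ?case
      using "3.IH"(2)[of a]
      by (simp add: partial_def contract_word drop_word partial_word_Cons[of _ _ _ a])
         (simp add: frag_of_Cons gen_mult_of_int algebra_simps)
  qed
qed (simp_all add: partial_diff contract_diff drop_diff)

section \<open>Substituting images of generators\<close>

text \<open>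
  Brackets and weights are zero at infinity because \<^term>\<open>gen_proj Infty\<close> is zero: deleting or
  contracting a vanishing factor has to give zero.
\<close>

definition proj_bracket :: "('a::field \<Rightarrow> int) \<Rightarrow> 'a proj_line \<Rightarrow> 'a proj_line \<Rightarrow> int" where
  "proj_bracket \<phi> P Q =
    (case (P, Q) of (Affine x, Affine y) \<Rightarrow> bracket \<phi> (x - y) | _ \<Rightarrow> 0)"

definition extend_by_zero :: "('a \<Rightarrow> int) \<Rightarrow> 'a proj_line \<Rightarrow> int" where
  "extend_by_zero f P = (case P of Affine x \<Rightarrow> f x | Infty \<Rightarrow> 0)"

definition pullback_weight :: "'a::field^2^2 \<Rightarrow> ('a \<Rightarrow> int) \<Rightarrow> 'a \<Rightarrow> int" where
  "pullback_weight \<gamma> f x =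
    extend_by_zero f (moebius \<gamma> (Affine x)) - extend_by_zero f (moebius \<gamma> Infty)"

lemma drop_first_gen_proj_mult:
  "drop_first f (gen_proj P * p) = of_int (extend_by_zero f P) * p"
  by (cases P) (simp_all add: extend_by_zero_def drop_first_gen_mult)

lemma drop_last_mult_gen_proj:
  "drop_last f (p * gen_proj P) = of_int (extend_by_zero f P) * p"
  by (cases P) (simp_all add: extend_by_zero_def drop_last_mult_gen)

text \<open>
  The first factor of the image of a word starting with \<open>x\<close> is \<open>e\<^bsub>\<gamma>x\<^esub> - e\<^bsub>\<gamma>\<infinity>\<^esub>\<close>, whose total
  weight is the pulled-back weight of \<open>x\<close>.
\<close>

lemma drop_first_gl_star:
  "drop_first f (gl_star \<gamma> p) = gl_star \<gamma> (drop_first (pullback_weight \<gamma> f) p)"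
proof (rule free_alg_eq_on_words[where F = "\<lambda>p. drop_first f (gl_star \<gamma> p)" and
      G = "\<lambda>p. gl_star \<gamma> (drop_first (pullback_weight \<gamma> f) p)"])
  show "drop_first f (gl_star \<gamma> (frag_of as)) =
    gl_star \<gamma> (drop_first (pullback_weight \<gamma> f) (frag_of as))" for as
  proof (cases as)
    case Nil
    then show ?thesis
      by (simp add: gl_star_def drop_word frag_of_Nil[symmetric])
  next
    case (Cons a v)
    then show ?thesis
      by (simp add: frag_of_Cons gl_star_mult gl_star_gen_eq gl_star_gen_def left_diff_distrib
          drop_diff drop_first_gen_proj_mult drop_first_gen_mult gl_star_of_int
          gl_star_diff pullback_weight_def del: moebius.simps)
  qed
qed (simp_all add: drop_diff gl_star_diff)

lemma drop_last_gl_star: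
  "drop_last f (gl_star \<gamma> p) = gl_star \<gamma> (drop_last (pullback_weight \<gamma> f) p)"
proof (rule free_alg_eq_on_words[where F = "\<lambda>p. drop_last f (gl_star \<gamma> p)" and
      G = "\<lambda>p. gl_star \<gamma> (drop_last (pullback_weight \<gamma> f) p)"])
  show "drop_last f (gl_star \<gamma> (frag_of as)) =
    gl_star \<gamma> (drop_last (pullback_weight \<gamma> f) (frag_of as))" for as
  proof (cases as rule: rev_cases)
    case Nil
    then show ?thesis
      by (simp add: gl_star_def drop_word frag_of_Nil[symmetric])
  next
    case (snoc v a)
    then have "frag_of as = frag_of v * gen a"
      by (simp add: frag_of_append gen_def)
    then show ?thesis
      by (simp add: gl_star_mult gl_star_gen_eq gl_star_gen_def right_diff_distrib
          left_diff_distrib drop_diff drop_last_mult_gen_proj drop_last_mult_gen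
          gl_star_of_int gl_star_diff pullback_weight_def del: moebius.simps)
  qed
qed (simp_all add: drop_diff gl_star_diff)

lemma contract_gen_proj: "contract \<phi> (gen_proj P) = 0"
  by (cases P) (simp_all add: contract_gen)

text \<open>
  If one of the two points is infinite, the product on the left, the bracket and the recursive term
  all vanish.
\<close>

lemma contract_gen_proj_gen_proj_mult:
  "contract \<phi> (gen_proj P * (gen_proj Q * p)) =
    of_int (proj_bracket \<phi> Q P) * (gen_proj Q - gen_proj P) * p
    + gen_proj P * contract \<phi> (gen_proj Q * p)"
  by (cases P; cases Q) (simp_all add: proj_bracket_def contract_gen_gen_mult)

section \<open>Brackets of Moebius images\<close>

lemma bracket_mult:
  assumes "units_hom \<phi>" "x \<noteq> 0" "y \<noteq> 0"
  shows "bracket \<phi> (x * y) = bracket \<phi> x + bracket \<phi> y"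
  using assms by (simp add: units_hom_def bracket_def)

lemma bracket_divide:
  assumes "units_hom \<phi>" "x \<noteq> 0" "y \<noteq> 0"
  shows "bracket \<phi> (x / y) = bracket \<phi> x - bracket \<phi> y"
  using bracket_mult[OF assms(1), of "x / y" y] assms by simp

text \<open>The integers are torsion-free, so the value of the homomorphism at \<open>-1\<close> is zero.\<close>

lemma bracket_uminus:
  assumes "units_hom \<phi>"
  shows "bracket \<phi> (- x) = bracket \<phi> x"
proof (cases "x = 0")
  case False
  have "bracket \<phi> 1 = 0"
    using bracket_mult[OF assms, of 1 1] by simp
  then have "bracket \<phi> (- 1) = 0"
    using bracket_mult[OF assms, of "- 1" "- 1"] by simp
  then show ?thesis
    using bracket_mult[OF assms, of "- 1" x] False by simp
qed simp

lemma bracket_diff_commute: "units_hom \<phi> \<Longrightarrow> bracket \<phi> (x - y) = bracket \<phi> (y - x)"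
  using bracket_uminus[of \<phi> "x - y"] by simp

lemma proj_bracket_self: "proj_bracket \<phi> P P = 0"
  by (cases P) (simp_all add: proj_bracket_def bracket_def)

lemma proj_bracket_commute: "units_hom \<phi> \<Longrightarrow> proj_bracket \<phi> P Q = proj_bracket \<phi> Q P"
  by (cases P; cases Q) (simp_all add: proj_bracket_def bracket_diff_commute)

text \<open>
  The constant in the three-point identity below. If \<open>\<gamma>\<close> fixes infinity, it is \<^term>\<open>- eps \<phi> \<gamma> z\<close>,
  which is then the same for all \<open>z\<close>; otherwise it is \<^term>\<open>eps \<phi> \<gamma> z\<close> with \<open>cz + d\<close> replaced by its
  leading coefficient \<open>c\<close>.
\<close>

definition pole_const :: "('a::field \<Rightarrow> int) \<Rightarrow> 'a^2^2 \<Rightarrow> int" where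
  "pole_const \<phi> \<gamma> =
    (if \<gamma>$2$1 = 0 then 2 * bracket \<phi> (\<gamma>$2$2) - bracket \<phi> (det \<gamma>)
     else bracket \<phi> (det \<gamma>) - 2 * bracket \<phi> (\<gamma>$2$1))"

lemma bracket_moebius_diff:
  assumes hom: "units_hom \<phi>" and det: "det \<gamma> \<noteq> 0" and "x \<noteq> s"
    and "\<gamma>$2$1 * x + \<gamma>$2$2 \<noteq> 0" "\<gamma>$2$1 * s + \<gamma>$2$2 \<noteq> 0"
  shows "proj_bracket \<phi> (moebius \<gamma> (Affine x)) (moebius \<gamma> (Affine s)) =
    bracket \<phi> (det \<gamma>) + bracket \<phi> (x - s)
    - bracket \<phi> (\<gamma>$2$1 * x + \<gamma>$2$2) - bracket \<phi> (\<gamma>$2$1 * s + \<gamma>$2$2)"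
proof -
  have "(\<gamma>$1$1 * x + \<gamma>$1$2) / (\<gamma>$2$1 * x + \<gamma>$2$2)
      - (\<gamma>$1$1 * s + \<gamma>$1$2) / (\<gamma>$2$1 * s + \<gamma>$2$2) =
    (det \<gamma> * (x - s)) / ((\<gamma>$2$1 * x + \<gamma>$2$2) * (\<gamma>$2$1 * s + \<gamma>$2$2))"
    using assms(4,5) by (simp add: diff_frac_eq det_2 algebra_simps)
  then show ?thesis
    using assms by (simp add: proj_bracket_def bracket_mult bracket_divide)
qed

lemma bracket_moebius_diff_Infty:
  assumes hom: "units_hom \<phi>" and det: "det \<gamma> \<noteq> 0"
    and "\<gamma>$2$1 \<noteq> 0" "\<gamma>$2$1 * s + \<gamma>$2$2 \<noteq> 0"
  shows "proj_bracket \<phi> (moebius \<gamma> Infty) (moebius \<gamma> (Affine s)) =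
    bracket \<phi> (det \<gamma>) - bracket \<phi> (\<gamma>$2$1) - bracket \<phi> (\<gamma>$2$1 * s + \<gamma>$2$2)"
proof -
  have "\<gamma>$1$1 / \<gamma>$2$1 - (\<gamma>$1$1 * s + \<gamma>$1$2) / (\<gamma>$2$1 * s + \<gamma>$2$2) =
    det \<gamma> / (\<gamma>$2$1 * (\<gamma>$2$1 * s + \<gamma>$2$2))"
    using assms(3,4) by (simp add: diff_frac_eq det_2 algebra_simps)
  then show ?thesis
    using assms by (simp add: proj_bracket_def bracket_mult bracket_divide)
qed

text \<open>
  For distinct \<open>x\<close> and \<open>s\<close> with finite images and \<open>c \<noteq> 0\<close>, the difference \<open>\<gamma>x - \<gamma>s\<close> is
  \<open>det \<gamma> (x - s) / ((cx + d) (cs + d))\<close>, and the differences with \<open>\<gamma>\<infinity>\<close> carry the same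
  factors \<open>cx + d\<close> and \<open>cs + d\<close>, which therefore cancel. The constant is what remains; it absorbs these
  factors directly when \<open>c = 0\<close>. For \<open>x = s\<close> the first bracket on the left and the one on the right
  are zero by convention, and the terms that no longer cancel amount to
  \<open>-\<epsilon>\<^sub>\<gamma>(s)\<close>.
\<close>

lemma bracket_three_point:
  assumes hom: "units_hom \<phi>" and det: "det \<gamma> \<noteq> 0" and s: "moebius \<gamma> (Affine s) \<noteq> Infty"
  shows "proj_bracket \<phi> (moebius \<gamma> (Affine x)) (moebius \<gamma> (Affine s))
      - proj_bracket \<phi> (moebius \<gamma> Infty) (moebius \<gamma> (Affine s))
      - proj_bracket \<phi> (moebius \<gamma> Infty) (moebius \<gamma> (Affine x)) + pole_const \<phi> \<gamma> =
    bracket \<phi> (x - s) - of_bool (x = s) * eps \<phi> \<gamma> s"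
proof -
  define c d where "c = \<gamma>$2$1" and "d = \<gamma>$2$2"
  have s': "c * s + d \<noteq> 0"
    using s by (auto simp: c_def d_def split: if_splits)
  show ?thesis
  proof (cases "c = 0")
    case True
    have "proj_bracket \<phi> (moebius \<gamma> Infty) P = 0" for P
      using True by (simp add: c_def proj_bracket_def)
    then show ?thesis
      using True s' bracket_moebius_diff[OF hom det, of x s]
      by (cases "x = s") (simp_all add: proj_bracket_self pole_const_def eps_def c_def d_def bracket_def del: moebius.simps)
  next
    case c: False
    note inf = bracket_moebius_diff_Infty[OF hom det, folded c_def d_def, OF c]
    show ?thesis
    proof (cases "c * x + d = 0")
      case True
      then have "moebius \<gamma> (Affine x) = Infty"
        by (simp add: c_def d_def)
      moreover have "x \<noteq> s"
        using True s' by auto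
      moreover
      \<comment> \<open>Here \<open>x = -d/c\<close> is the pole of \<open>\<gamma>\<close>, so only the bracket between \<open>\<gamma>\<infinity>\<close> and \<open>\<gamma>s\<close> survives on the left.\<close>
      have "x - s = - ((c * s + d) / c)"
        using True c by (simp add: field_simps eq_neg_iff_add_eq_0)
      then have "bracket \<phi> (x - s) = bracket \<phi> (c * s + d) - bracket \<phi> c"
        using c s' by (simp add: bracket_uminus[OF hom] bracket_divide[OF hom])
      moreover have "proj_bracket \<phi> Infty P = 0" "proj_bracket \<phi> P Infty = 0" for P
        by (cases P; simp add: proj_bracket_def)+
      ultimately show ?thesis
        using c by (simp add: inf[OF s'] pole_const_def c_def d_def del: moebius.simps)
    next
      case False
      show ?thesis
        using c False s' inf[OF False] inf[OF s'] bracket_moebius_diff[OF hom det, of x s]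
        by (cases "x = s")
          (simp_all add: proj_bracket_self pole_const_def eps_def c_def d_def bracket_def[of _ 0] del: moebius.simps)
    qed
  qed
qed

section \<open>Equivariance up to boundary terms\<close>

text \<open>
  For invertible \<open>\<gamma>\<close> and nonzero \<open>c\<close> and \<open>cx + d\<close>, this is \<open>[cx + d] - [c]\<close>.
\<close>

definition boundary_weight :: "('a::field \<Rightarrow> int) \<Rightarrow> 'a^2^2 \<Rightarrow> 'a \<Rightarrow> int" where
  "boundary_weight \<phi> \<gamma> x =
    pole_const \<phi> \<gamma> - proj_bracket \<phi> (moebius \<gamma> Infty) (moebius \<gamma> (Affine x))"

text \<open>
  Expanding \<open>(e\<^bsub>\<gamma>x\<^esub> - e\<^bsub>\<gamma>\<infinity>\<^esub>) (e\<^bsub>\<gamma>y\<^esub> - e\<^bsub>\<gamma>\<infinity>\<^esub>)\<close> and contracting gives a combination of the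
  generators at \<open>\<gamma>x\<close>, \<open>\<gamma>y\<close> and \<open>\<gamma>\<infinity>\<close>. The coefficients of the first two are differences of
  brackets evaluated by the three-point identity, applied once with \<open>y\<close> and once with \<open>x\<close> as the base
  point; the coefficient at \<open>\<gamma>\<infinity>\<close> is a difference of boundary weights by definition.
\<close>

lemma contract_gl_star_pair:
  assumes hom: "units_hom \<phi>" and det: "det \<gamma> \<noteq> 0"
  shows "contract \<phi> (gl_star \<gamma> (gen x) * (gl_star \<gamma> (gen y) * p)) =
    gl_star \<gamma> (of_int (bracket \<phi> (y - x)) * (gen y - gen x)
      + of_int (boundary_weight \<phi> \<gamma> y) * gen x - of_int (boundary_weight \<phi> \<gamma> x) * gen y) * p
    + gl_star \<gamma> (gen x) * contract \<phi> (gl_star \<gamma> (gen y) * p)"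
proof -
  define X Y Z where "X = moebius \<gamma> (Affine x)" and "Y = moebius \<gamma> (Affine y)"
    and "Z = moebius \<gamma> Infty"
  define B H where "B = bracket \<phi> (y - x)" and "H = boundary_weight \<phi> \<gamma>"
  have Hx: "proj_bracket \<phi> Z X = pole_const \<phi> \<gamma> - H x" and Hy: "proj_bracket \<phi> Z Y = pole_const \<phi> \<gamma> - H y"
    by (simp_all add: H_def boundary_weight_def X_def Y_def Z_def)
  define E where "E = of_bool (x = y) * eps \<phi> \<gamma> y"
  \<comment> \<open>The identity needs a finite base point; at an infinite one the generator itself is zero.\<close>
  have cY: "of_int (proj_bracket \<phi> Y X - proj_bracket \<phi> Y Z) * gen_proj Y =
      of_int (B - H x - E) * gen_proj Y"
  proof (cases "Y = Infty")
    case False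
    have "bracket \<phi> (x - y) = B"
      by (simp add: B_def bracket_diff_commute[OF hom])
    then have "proj_bracket \<phi> Y X - proj_bracket \<phi> Y Z = B - H x - E"
      using bracket_three_point[OF hom det False[unfolded Y_def], of x, folded X_def Y_def Z_def E_def]
      unfolding Hx proj_bracket_commute[OF hom, of Y] by linarith
    then show ?thesis
      by presburger
  qed simp
  have cX: "of_int (proj_bracket \<phi> Y X - proj_bracket \<phi> Z X) * gen_proj X =
      of_int (B - H y - E) * gen_proj X"
  proof (cases "X = Infty")
    case False
    have "of_bool (y = x) * eps \<phi> \<gamma> x = E"
      by (simp add: E_def)
    then have "proj_bracket \<phi> Y X - proj_bracket \<phi> Z X = B - H y - E"
      using bracket_three_point[OF hom det False[unfolded X_def], of y, folded X_def Y_def Z_def B_def]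
      unfolding Hy by linarith
    then show ?thesis
      by presburger
  qed simp
  have "of_int (proj_bracket \<phi> Y X) * (gen_proj Y - gen_proj X)
      - of_int (proj_bracket \<phi> Y Z) * (gen_proj Y - gen_proj Z)
      - of_int (proj_bracket \<phi> Z X) * (gen_proj Z - gen_proj X) =
      of_int (proj_bracket \<phi> Y X - proj_bracket \<phi> Y Z) * gen_proj Y
      - of_int (proj_bracket \<phi> Y X - proj_bracket \<phi> Z X) * gen_proj X
      + of_int (proj_bracket \<phi> Y Z - proj_bracket \<phi> Z X) * gen_proj Z"
    by (simp add: algebra_simps)
  also have "\<dots> = of_int (B - H x - E) * gen_proj Y - of_int (B - H y - E) * gen_proj X
      + of_int (H x - H y) * gen_proj Z"
    unfolding cX cY by (simp add: Hx Hy proj_bracket_commute[OF hom, of Y])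
  also have "\<dots> = of_int (B - H x) * gen_proj Y - of_int (B - H y) * gen_proj X
      + of_int (H x - H y) * gen_proj Z"
    \<comment> \<open>\<open>E\<close> is zero unless \<open>x = y\<close>, and then the two terms containing it cancel.\<close>
    by (cases "x = y") (simp_all add: E_def X_def Y_def del: moebius.simps)
  also have "\<dots> = gl_star \<gamma> (of_int B * (gen y - gen x) + of_int (H y) * gen x - of_int (H x) * gen y)"
    by (simp add: gl_star_add gl_star_diff gl_star_of_int_mult gl_star_gen_eq gl_star_gen_def
        X_def[symmetric] Y_def[symmetric] Z_def[symmetric] algebra_simps del: moebius.simps)
  finally have coeff: "of_int (proj_bracket \<phi> Y X) * (gen_proj Y - gen_proj X)
      - of_int (proj_bracket \<phi> Y Z) * (gen_proj Y - gen_proj Z)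
      - of_int (proj_bracket \<phi> Z X) * (gen_proj Z - gen_proj X) =
      gl_star \<gamma> (of_int B * (gen y - gen x) + of_int (H y) * gen x - of_int (H x) * gen y)" .
  show ?thesis
    unfolding B_def[symmetric] H_def[symmetric] coeff[symmetric]
    unfolding gl_star_gen_eq gl_star_gen_def X_def[symmetric] Y_def[symmetric] Z_def[symmetric]
    by (simp add: left_diff_distrib right_diff_distrib contract_diff mult.assoc
        contract_gen_proj_gen_proj_mult proj_bracket_self)
qed

text \<open>
  Each inner letter of a word is the right member of one pair and the left member of the next, so its
  two weighted deletions from \<open>contract_gl_star_pair\<close> cancel. Those of the end letters remain.
\<close>

lemma contract_gl_star:
  assumes hom: "units_hom \<phi>" and det: "det \<gamma> \<noteq> 0"
  shows "contract \<phi> (gl_star \<gamma> p) =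
    gl_star \<gamma> (contract \<phi> p - drop_first (boundary_weight \<phi> \<gamma>) p + drop_last (boundary_weight \<phi> \<gamma>) p)"
proof -
  let ?H = "boundary_weight \<phi> \<gamma>"
  have words: "contract \<phi> (gl_star \<gamma> (frag_of as)) =
    gl_star \<gamma> (contract \<phi> (frag_of as) - drop_first ?H (frag_of as) + drop_last ?H (frag_of as))" for as
  proof (induction as rule: induct_list012)
    case 1
    then show ?case
      by (simp add: gl_star_def contract_word drop_word frag_of_Nil[symmetric])
  next
    case (2 x)
    have "contract \<phi> (gl_star \<gamma> (gen x)) = 0"
      by (simp add: gl_star_gen_eq gl_star_gen_def contract_diff drop_diff contract_gen_proj)
    moreover have "drop_first ?H (gen x) = drop_last ?H (gen x)"
      by (simp add: gen_def drop_word)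
    ultimately show ?case
      by (simp add: contract_gen flip: gen_def)
  next
    case (3 x y as)
    have last: "drop_last ?H (frag_of (x # y # as)) = gen x * drop_last ?H (frag_of (y # as))"
      by (simp add: drop_word) (simp add: frag_of_Cons gen_mult_of_int)
    have "contract \<phi> (gl_star \<gamma> (frag_of (x # y # as))) =
      contract \<phi> (gl_star \<gamma> (gen x) * (gl_star \<gamma> (gen y) * gl_star \<gamma> (frag_of as)))"
      by (simp add: frag_of_Cons gl_star_mult)
    also have "\<dots> = gl_star \<gamma> ((of_int (bracket \<phi> (y - x)) * (gen y - gen x)
        + of_int (?H y) * gen x - of_int (?H x) * gen y) * frag_of as
        + gen x * (contract \<phi> (frag_of (y # as)) - drop_first ?H (frag_of (y # as))
            + drop_last ?H (frag_of (y # as))))"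
      by (simp only: contract_gl_star_pair[OF hom det])
        (simp only: gl_star_mult[symmetric] frag_of_Cons[symmetric] "3.IH"(2) gl_star_add[symmetric])
    also have "\<dots> = gl_star \<gamma> (contract \<phi> (frag_of (x # y # as))
        - drop_first ?H (frag_of (x # y # as)) + drop_last ?H (frag_of (x # y # as)))"
      unfolding last
      unfolding frag_of_Cons contract_gen_gen_mult drop_first_gen_mult
      by (simp add: algebra_simps gen_mult_of_int)
    finally show ?case .
  qed
  show ?thesis
    by (rule free_alg_eq_on_words[where F = "\<lambda>p. contract \<phi> (gl_star \<gamma> p)" and
          G = "\<lambda>p. gl_star \<gamma> (contract \<phi> p - drop_first ?H p + drop_last ?H p)"])
      (simp_all only: words, simp_all add: contract_diff drop_diff gl_star_diff gl_star_add)
qed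

lemma drop_first_weight_add: "drop_first (\<lambda>a. f a + g a) p = drop_first f p + drop_first g p"
  by (rule free_alg_eq_on_words[where F = "drop_first (\<lambda>a. f a + g a)" and G = "\<lambda>p. drop_first f p + drop_first g p"])
    (simp_all add: drop_diff, simp add: drop_word algebra_simps)

lemma drop_last_weight_add: "drop_last (\<lambda>a. f a + g a) p = drop_last f p + drop_last g p"
  by (rule free_alg_eq_on_words[where F = "drop_last (\<lambda>a. f a + g a)" and G = "\<lambda>p. drop_last f p + drop_last g p"])
    (simp_all add: drop_diff, simp add: drop_word algebra_simps)

text \<open>
  The three-point identity, read as a comparison of the weights with which the differentials at
  \<open>s\<close> and at \<open>\<gamma>(s)\<close> delete an end letter.
\<close>

lemma pullback_weight_bracket:
  assumes hom: "units_hom \<phi>" and det: "det \<gamma> \<noteq> 0" and s: "moebius \<gamma> (Affine s) \<noteq> Infty"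
  shows "bracket \<phi> (x - s) = pullback_weight \<gamma> (\<lambda>a. bracket \<phi> (a - the_affine (moebius \<gamma> (Affine s)))) x
    + (boundary_weight \<phi> \<gamma> x + of_bool (x = s) * eps \<phi> \<gamma> s)"
proof -
  obtain u where u: "moebius \<gamma> (Affine s) = Affine u"
    using s by (cases "moebius \<gamma> (Affine s)") auto
  have "extend_by_zero (\<lambda>a. bracket \<phi> (a - u)) P = proj_bracket \<phi> P (Affine u)" for P
    by (cases P) (simp_all add: extend_by_zero_def proj_bracket_def)
  then show ?thesis
    using bracket_three_point[OF assms, of x] u
    by (simp add: pullback_weight_def boundary_weight_def del: moebius.simps)
qed

text \<open>
  The \<^const>\<open>boundary_weight\<close> terms produced by \<^const>\<open>contract\<close> are opposite to those produced by the
  two boundary operators.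
\<close>

lemma partial_gl_star:
  assumes hom: "units_hom \<phi>" and det: "det \<gamma> \<noteq> 0"
    and s: "moebius \<gamma> (Affine s) \<noteq> Infty" and t: "moebius \<gamma> (Affine t) \<noteq> Infty"
  shows "partial \<phi> (the_affine (moebius \<gamma> (Affine s))) (the_affine (moebius \<gamma> (Affine t))) (gl_star \<gamma> p) =
    gl_star \<gamma> (partial \<phi> s t p + drop_first (\<lambda>x. of_bool (x = s) * eps \<phi> \<gamma> s) p
      - drop_last (\<lambda>y. of_bool (y = t) * eps \<phi> \<gamma> t) p)"
  unfolding partial_eq_contract_drop bracket_diff_commute[OF hom, of t]
    bracket_diff_commute[OF hom, of "the_affine (moebius \<gamma> (Affine t))"]
  unfolding pullback_weight_bracket[OF hom det s] pullback_weight_bracket[OF hom det t]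
    drop_first_weight_add drop_last_weight_add contract_gl_star[OF hom det] drop_first_gl_star drop_last_gl_star
  by (simp add: gl_star_add gl_star_diff)

section \<open>Inverting the action\<close>

lemma moebius_matrix_inv:
  assumes "invertible \<gamma>"
  shows "moebius (matrix_inv \<gamma>) (moebius \<gamma> P) = P"
proof -
  define a b c d where "a = \<gamma>$1$1" and "b = \<gamma>$1$2" and "c = \<gamma>$2$1" and "d = \<gamma>$2$2"
  define p q r s where "p = matrix_inv \<gamma>$1$1" and "q = matrix_inv \<gamma>$1$2"
    and "r = matrix_inv \<gamma>$2$1" and "s = matrix_inv \<gamma>$2$2"
  have "matrix_inv \<gamma> ** \<gamma> = mat 1"
    using assms unfolding invertible_def matrix_inv_def by (rule someI2_ex) simp
  then have "(matrix_inv \<gamma> ** \<gamma>)$i$j = (if i = j then 1 else 0)" for i j :: 2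
    by (simp add: mat_def)
  from this[of 1 1] this[of 1 2] this[of 2 1] this[of 2 2]
  have eqs: "p * a + q * c = 1" "p * b + q * d = 0" "r * a + s * c = 0" "r * b + s * d = 1"
    by (simp_all add: matrix_matrix_mult_def sum_2 p_def q_def r_def s_def a_def b_def c_def d_def)
  show ?thesis
  proof (cases P)
    case Infty
    have "r = 0" if "c = 0"
      using eqs that by auto
    moreover have "r * (a / c) + s = 0" if "c \<noteq> 0"
      using eqs(3) that by (simp add: field_simps)
    ultimately show ?thesis
      using Infty by (simp add: a_def b_def c_def d_def r_def s_def)
  next
    case (Affine x)
    have num: "p * (a * x + b) + q * (c * x + d) = x"
      using eqs(1,2) by algebra
    have den: "r * (a * x + b) + s * (c * x + d) = 1"
      using eqs(3,4) by algebra
    show ?thesis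
    proof (cases "c * x + d = 0")
      case True
      have "r \<noteq> 0"
        using den True by auto
      moreover have "p / r = x"
      proof -
        have "p * (a * x + b) = x" "r * (a * x + b) = 1"
          using num den True by simp_all
        moreover have "p * (r * (a * x + b)) = r * (p * (a * x + b))"
          by (rule mult.left_commute)
        ultimately have "p = r * x"
          by simp
        then show ?thesis
          using \<open>r \<noteq> 0\<close> by simp
      qed
      ultimately show ?thesis
        using Affine True by (simp add: c_def d_def p_def r_def)
    next
      case False
      have "r * ((a * x + b) / (c * x + d)) + s = 1 / (c * x + d)"
        using den False by (simp add: field_simps)
      moreover have "p * ((a * x + b) / (c * x + d)) + q = x / (c * x + d)"
        using num False by (simp add: field_simps)
      ultimately show ?thesis
        using Affine False by (simp add: a_def b_def c_def d_def p_def q_def r_def s_def)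
    qed
  qed
qed

text \<open>
  The terms at infinity cancel: \<open>(\<gamma>\<^sup>-\<^sup>1)\<^sup>*\<close> maps \<open>e\<^bsub>\<gamma>x\<^esub> - e\<^bsub>\<gamma>\<infinity>\<^esub>\<close> to
  \<open>e\<^sub>x - e\<^sub>\<infinity>\<close>, and \<open>e\<^sub>\<infinity>\<close> is zero.
\<close>

lemma gl_star_matrix_inv:
  assumes "invertible \<gamma>"
  shows "gl_star (matrix_inv \<gamma>) (gl_star \<gamma> p) = p"
proof (rule free_alg_eq_on_words[where F = "\<lambda>p. gl_star (matrix_inv \<gamma>) (gl_star \<gamma> p)" and G = "\<lambda>p. p"])
  have proj: "gl_star \<gamma>' (gen_proj P) = gen_proj (moebius \<gamma>' P) - gen_proj (moebius \<gamma>' Infty)"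
    for \<gamma>' :: "'a^2^2" and P
    by (cases P) (simp_all add: gl_star_gen_eq gl_star_gen_def del: moebius.simps)
  have gen: "gl_star (matrix_inv \<gamma>) (gl_star \<gamma> (gen x)) = gen x" for x
    by (simp add: gl_star_gen_eq[of \<gamma>] gl_star_gen_def gl_star_diff proj moebius_matrix_inv[OF assms]
        del: moebius.simps)
  show "gl_star (matrix_inv \<gamma>) (gl_star \<gamma> (frag_of as)) = frag_of as" for as
    by (induction as) (simp_all add: frag_of_Nil gl_star_one frag_of_Cons gl_star_mult gen)
qed (simp_all add: gl_star_diff)

section \<open>The transformation formula\<close>

lemma drop_alg0:
  assumes "p \<in> alg0 s t"
  shows "(\<And>x. x \<noteq> s \<Longrightarrow> f x = 0) \<Longrightarrow> drop_first f p = 0"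
    and "(\<And>y. y \<noteq> t \<Longrightarrow> g y = 0) \<Longrightarrow> drop_last g p = 0"
proof -
  have first: "drop_first f (of_int n) = 0" and last: "drop_last g (of_int n) = 0" for n
  proof -
    have "drop_first f (of_int n * frag_of []) = of_int n * drop_first f (frag_of [])"
      "drop_last g (of_int n * frag_of []) = of_int n * drop_last g (frag_of [])"
      by (simp_all add: drop_first_def drop_last_def frag_extend_cmul flip: frag_cmul_conv_mult)
    then show "drop_first f (of_int n) = 0" "drop_last g (of_int n) = 0"
      by (simp_all add: drop_word) (simp_all add: frag_of_Nil)
  qed
  show "drop_first f p = 0" if f: "\<And>x. x \<noteq> s \<Longrightarrow> f x = 0"
    using assms
    by induction
      (simp_all add: first f mult_of_int_commute mult.assoc drop_first_gen_mult drop_add)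
  show "drop_last g p = 0" if g: "\<And>y. y \<noteq> t \<Longrightarrow> g y = 0"
    using assms
    by induction
      (simp_all add: last g drop_last_mult_gen drop_add)
qed

theorem theorem9:
  fixes \<phi> :: "'a::field \<Rightarrow> int" and \<gamma> :: "'a^2^2" and s t :: 'a
  assumes "units_hom \<phi>"
    and "invertible \<gamma>"
    and "moebius \<gamma> (Affine s) \<noteq> Infty"
    and "moebius \<gamma> (Affine t) \<noteq> Infty"
  shows "(\<forall>w w' w'' x y.
            w \<in> monomials \<longrightarrow> w' \<in> monomials \<longrightarrow> w'' \<in> monomials \<longrightarrow>
            w = gen x * w' \<longrightarrow> w = w'' * gen y \<longrightarrow>
            gl_star (matrix_inv \<gamma>)
                (partial \<phi> (the_affine (moebius \<gamma> (Affine s))) (the_affine (moebius \<gamma> (Affine t)))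
                  (gl_star \<gamma> w)) =
              partial \<phi> s t w
              + of_int (of_bool (x = s) * eps \<phi> \<gamma> s) * w'
              - of_int (of_bool (y = t) * eps \<phi> \<gamma> t) * w'')
       \<and> (\<forall>w \<in> alg0 s t.
            gl_star (matrix_inv \<gamma>)
                (partial \<phi> (the_affine (moebius \<gamma> (Affine s))) (the_affine (moebius \<gamma> (Affine t)))
                  (gl_star \<gamma> w)) =
              partial \<phi> s t w)"
proof -
  have det: "det \<gamma> \<noteq> 0"
    using assms(2) by (simp add: invertible_det_nz)
  have conjugate: "gl_star (matrix_inv \<gamma>)
        (partial \<phi> (the_affine (moebius \<gamma> (Affine s))) (the_affine (moebius \<gamma> (Affine t)))
          (gl_star \<gamma> w)) =
      partial \<phi> s t w + drop_first (\<lambda>x. of_bool (x = s) * eps \<phi> \<gamma> s) w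
        - drop_last (\<lambda>y. of_bool (y = t) * eps \<phi> \<gamma> t) w" for w
    unfolding partial_gl_star[OF assms(1) det assms(3,4)] gl_star_matrix_inv[OF assms(2)] ..
  show ?thesis
  proof (intro conjI allI impI ballI)
    fix w w' w'' :: "'a free_alg" and x y
    assume "w = gen x * w'" and "w = w'' * gen y"
    then have "drop_first f w = of_int (f x) * w'" "drop_last f w = of_int (f y) * w''" for f
      by (metis drop_first_gen_mult, metis drop_last_mult_gen)
    then show "gl_star (matrix_inv \<gamma>)
        (partial \<phi> (the_affine (moebius \<gamma> (Affine s))) (the_affine (moebius \<gamma> (Affine t)))
          (gl_star \<gamma> w)) =
      partial \<phi> s t w + of_int (of_bool (x = s) * eps \<phi> \<gamma> s) * w'
        - of_int (of_bool (y = t) * eps \<phi> \<gamma> t) * w''"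
      unfolding conjugate by simp
  next
    fix w
    assume "w \<in> alg0 s t"
    then show "gl_star (matrix_inv \<gamma>)
        (partial \<phi> (the_affine (moebius \<gamma> (Affine s))) (the_affine (moebius \<gamma> (Affine t)))
          (gl_star \<gamma> w)) =
      partial \<phi> s t w"
      unfolding conjugate by (simp add: drop_alg0)
  qed
qed

end
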